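(* Let $B=F(b_1,\ldots,b_n)$ be a Ferrers board with $0\le b_1\le\cdots\le b_n$ and $b_n>0$. Then for all positive integers $x$, $$[x+F_{b_1}]_q[x+F_{b_2}]_q\cdots[x+F_{b_n}]_q=\sum_{k=0}^n\mathbf{FT}_k(B,q)\,[x]_q^{n-k}$$ and $$([x]_q+[F_{b_1}]_q)([x]_q+[F_{b_2}]_q)\cdots([x]_q+[F_{b_n}]_q)=\sum_{k=0}^n\overline{\mathbf{FT}}_k(B,q)\,[x]_q^{n-k}.$$
   Context: Fibonacci numbers: $F_0=0$, $F_1=1$, $F_m=F_{m-1}+F_{m-2}$. For an integer $m$, $[m]_q=\frac{1-q^m}{1-q}$ (so $[0]_q=0$). For $m\ge1$, $\mathcal{F}_m$ is the set of tilings of a column of height $m$ (levels $1,\dots,m$ from the bottom) by tiles of heights 1 and 2 whose bottom-most tile has height 1; $\mathcal{F}_0=\emptyset$. For $T\in\mathcal{F}_m$, $\mathrm{rank}_m(T)=\sum F_{i-1}$, the sum over all $i$ such that $T$ has a tile of height 2 occupying levels $i-1$ and $i$. A Ferrers board $F(b_1,\dots,b_n)$ has columns $1,\dots,n$ of heights $b_1\le\cdots\le b_n$. For $0\le k\le n$, $\mathcal{FT}_k(B)$ is the set of Fibonacci file placements: a set $I$ of $k$ columns together with, for each $i\in I$, a tiling $T_i\in\mathcal{F}_{b_i}$ ($k=0$: only the empty placement). For such $P$, $w_{B,q}(P)=q^{\sum_{i\in I}\mathrm{rank}_{b_i}(T_i)+\sum_{j\notin I}F_{b_j}}$ and $\overline{w}_{B,q}(P)=q^{\sum_{i\in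 I}\mathrm{rank}_{b_i}(T_i)}$. Then $\mathbf{FT}_k(B,q)=\sum_{P\in\mathcal{FT}_k(B)}w_{B,q}(P)$ and $\overline{\mathbf{FT}}_k(B,q)=\sum_{P\in\mathcal{FT}_k(B)}\overline{w}_{B,q}(P)$. *)

theory Defs
  imports Complex_Main "HOL-Number_Theory.Fib" "HOL-Library.FuncSet" "HOL-Library.Disjoint_Sets"
begin

text \<open>
  The parameter \<open>q\<close> ranges over the elements different from 1 of an arbitrary field. The case of an
  indeterminate is the instance where the field is a field of rational functions.
\<close>

definition qint :: "'a::field \<Rightarrow> int \<Rightarrow> 'a" where
  "qint q m = (1 - q powi m) / (1 - q)"

text \<open>
  A tile is the set of levels it occupies and a tiling of a column of height \<open>m\<close> is a partition of
  its levels \<open>{1..m}\<close> into tiles. In particular \<open>fib_tilings 0\<close> is empty.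
\<close>

definition fib_tilings :: "nat \<Rightarrow> nat set set set" where
  "fib_tilings m =
     {T. partition_on {1..m} T \<and> (\<forall>t\<in>T. \<exists>i. t = {i} \<or> t = {i, i + 1}) \<and> {1} \<in> T}"

lemma fib_tilings_0: "fib_tilings 0 = {}"
  by (auto simp: fib_tilings_def partition_on_def)

definition tiling_rank :: "nat \<Rightarrow> nat set set \<Rightarrow> nat" where
  "tiling_rank m T = (\<Sum>i\<in>{i\<in>{2..m}. {i - 1, i} \<in> T}. fib (i - 1))"

text \<open>
  The board \<open>F(b\<^sub>1, \<dots>, b\<^sub>n)\<close> is given by \<open>n\<close> and the values of \<open>b\<close> on \<open>{1..n}\<close>. A placement is a pair
  \<open>(I, T)\<close> with \<open>T\<close> extensional on \<open>I\<close>, so that distinct pairs are distinct placements.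
\<close>

definition fib_file_placements ::
    "nat \<Rightarrow> (nat \<Rightarrow> nat) \<Rightarrow> nat \<Rightarrow> (nat set \<times> (nat \<Rightarrow> nat set set)) set" where
  "fib_file_placements n b k =
     (SIGMA I:{I. I \<subseteq> {1..n} \<and> card I = k}. \<Pi>\<^sub>E i\<in>I. fib_tilings (b i))"

definition FT_weight ::
    "nat \<Rightarrow> (nat \<Rightarrow> nat) \<Rightarrow> 'a::field \<Rightarrow> nat set \<times> (nat \<Rightarrow> nat set set) \<Rightarrow> 'a" where
  "FT_weight n b q = (\<lambda>(I, T).
     q ^ ((\<Sum>i\<in>I. tiling_rank (b i) (T i)) + (\<Sum>j\<in>{1..n} - I. fib (b j))))"

definition FT_weight_bar ::
    "(nat \<Rightarrow> nat) \<Rightarrow> 'a::field \<Rightarrow> nat set \<times> (nat \<Rightarrow> nat set set) \<Rightarrow> 'a" where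
  "FT_weight_bar b q = (\<lambda>(I, T). q ^ (\<Sum>i\<in>I. tiling_rank (b i) (T i)))"

definition FT :: "nat \<Rightarrow> (nat \<Rightarrow> nat) \<Rightarrow> nat \<Rightarrow> 'a::field \<Rightarrow> 'a" where
  "FT n b k q = (\<Sum>P\<in>fib_file_placements n b k. FT_weight n b q P)"

definition FT_bar :: "nat \<Rightarrow> (nat \<Rightarrow> nat) \<Rightarrow> nat \<Rightarrow> 'a::field \<Rightarrow> 'a" where
  "FT_bar n b k q = (\<Sum>P\<in>fib_file_placements n b k. FT_weight_bar b q P)"

end

theory Submission
  imports Defs
begin

text \<open>
  Splitting a tiling of height \<open>m + 2\<close> according to its top tile shows that the generating function
  \<open>R\<^sub>m\<close> of the rank over the tilings of height \<open>m\<close> satisfies \<open>R\<^bsub>m+2\<^esub> = R\<^bsub>m+1\<^esub> + q\<^sup>f R\<^sub>m\<close> with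
  \<open>f = F\<^bsub>m+1\<^esub>\<close>, so \<open>R\<^sub>m = [F\<^sub>m]\<^sub>q\<close> by the addition rule \<open>[a + c]\<^sub>q = q\<^sup>c [a]\<^sub>q + [c]\<^sub>q\<close>. Both product
  formulas then arise by expanding the product over the columns: in each column one chooses either the
  term with the factor \<open>[x]\<^sub>q\<close> (the column is not in \<open>I\<close>) or the generating function of its tilings.
\<close>

lemma qint_add:
  assumes "q \<noteq> 1"
  shows "qint q (int a + int c) = q ^ c * qint q (int a) + qint q (int c)"
proof -
  \<comment> \<open>Both exponents are natural numbers, so this power law also covers
    \<open>q = 0\<close>.\<close>
  have "q powi (int a + int c) = q ^ c * q ^ a"
    by (metis of_nat_add power_int_of_nat power_add mult.commute)
  with assms show ?thesis
    by (simp add: qint_def field_simps)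
qed

lemma finite_fib_tilings: "finite (fib_tilings m)"
  by (rule finite_subset[OF _ finitely_many_partition_on[of "{1..m}"]]) (auto simp: fib_tilings_def)

lemma fib_tilings_subset: "T \<in> fib_tilings m \<Longrightarrow> t \<in> T \<Longrightarrow> t \<subseteq> {1..m}"
  by (auto simp: fib_tilings_def partition_on_def)

text \<open>The hypotheses make \<open>p\<close> a tile at the top, leaving exactly the levels
  \<open>{1..l}\<close> to the rest. Since \<open>p \<noteq> {1}\<close>, the condition on the
  bottom tile passes unchanged between \<open>T\<close> and \<open>insert p T\<close>.\<close>

lemma insert_in_fib_tilings_iff:
  assumes "disjnt p (\<Union>T)" "p \<subseteq> {1..m}" "{1..m} - p = {1..l}" "p \<noteq> {1}"
    and "\<exists>i. p = {i} \<or> p = {i, i + 1}"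
  shows "insert p T \<in> fib_tilings m \<longleftrightarrow> T \<in> fib_tilings l"
proof -
  have "p \<noteq> {}"
    using assms(5) by auto
  then show ?thesis
    using assms partition_on_insert[OF assms(1), of "{1..m}"] by (auto simp: fib_tilings_def)
qed

text \<open>The tiles of \<open>T\<close> stay inside \<open>{1..l}\<close>, the complement of
  \<open>p\<close>, which supplies the disjointness.\<close>

lemma insert_in_fib_tilings:
  assumes "T \<in> fib_tilings l" "p \<subseteq> {1..m}" "{1..m} - p = {1..l}" "p \<noteq> {1}"
    and "\<exists>i. p = {i} \<or> p = {i, i + 1}"
  shows "insert p T \<in> fib_tilings m"
proof -
  have "disjnt p (\<Union>T)"
    using fib_tilings_subset[OF assms(1)] unfolding assms(3)[symmetric] disjnt_iff by blast
  from insert_in_fib_tilings_iff[OF this assms(2-5)] assms(1) show ?thesis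
    by (rule iffD2)
qed

lemma remove_in_fib_tilings:
  assumes "T \<in> fib_tilings m" "p \<in> T" "{1..m} - p = {1..l}" "p \<noteq> {1}"
  shows "T - {p} \<in> fib_tilings l"
proof -
  have tile: "\<exists>i. p = {i} \<or> p = {i, i + 1}" and "disjoint T"
    using assms by (auto simp: fib_tilings_def partition_on_def)
  from this(2) have "disjnt p (\<Union>(T - {p}))"
    using assms(2) unfolding disjnt_iff disjoint_def by blast
  from insert_in_fib_tilings_iff[OF this fib_tilings_subset[OF assms(1,2)] assms(3,4) tile]
  show ?thesis
    using assms(1,2) by (simp add: insert_absorb)
qed

lemma fib_tilings_1: "fib_tilings (Suc 0) = {{{1}}}"
proof -
  have "T = {{1}}" if "T \<in> fib_tilings (Suc 0)" for T
    using that fib_tilings_subset[OF that]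
    by (auto simp: fib_tilings_def partition_on_def subset_singleton_iff)
  moreover have "{{1}} \<in> fib_tilings (Suc 0)"
    by (auto simp: fib_tilings_def partition_on_def)
  ultimately show ?thesis
    by blast
qed

lemma fib_tilings_Suc_Suc:
  "fib_tilings (Suc (Suc m)) =
     insert {Suc (Suc m)} ` fib_tilings (Suc m) \<union> insert {Suc m, Suc (Suc m)} ` fib_tilings m"
  (is "?L = insert ?s ` ?A \<union> insert ?d ` ?B")
proof
  have s: "{1..Suc (Suc m)} - ?s = {1..Suc m}" and d: "{1..Suc (Suc m)} - ?d = {1..m}"
    by auto
  show "insert ?s ` ?A \<union> insert ?d ` ?B \<subseteq> ?L"
  proof (rule Un_least; rule image_subsetI)
    show "insert ?s T \<in> ?L" if "T \<in> ?A" for T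
      by (rule insert_in_fib_tilings[OF that _ s]) auto
    show "insert ?d T \<in> ?L" if "T \<in> ?B" for T
      by (rule insert_in_fib_tilings[OF that _ d]) auto
  qed
  show "?L \<subseteq> insert ?s ` ?A \<union> insert ?d ` ?B"
  proof
    fix T assume T: "T \<in> ?L"
    then have "\<Union>T = {1..Suc (Suc m)}"
      by (simp add: fib_tilings_def partition_on_def)
    then obtain t where t: "t \<in> T" "Suc (Suc m) \<in> t"
      by (metis Union_iff atLeastAtMost_iff le_refl One_nat_def Suc_le_mono zero_le)
    moreover obtain i where "t = {i} \<or> t = {i, i + 1}"
      using T t(1) unfolding fib_tilings_def by blast
    \<comment> \<open>The tile covering the top level cannot extend above it, which leaves
      \<open>i = Suc (Suc m)\<close> for height 1 and \<open>i = Suc m\<close> for height 2.\<close>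
    ultimately consider "t = ?s" | "t = ?d"
      using fib_tilings_subset[OF T t(1)] by fastforce
    then show "T \<in> insert ?s ` ?A \<union> insert ?d ` ?B"
    proof cases
      case 1
      have "T - {?s} \<in> ?A"
        by (rule remove_in_fib_tilings[OF T _ s]) (use t 1 in auto)
      moreover have "T = insert ?s (T - {?s})"
        using t 1 by auto
      ultimately show ?thesis by blast
    next
      case 2
      have "T - {?d} \<in> ?B"
        by (rule remove_in_fib_tilings[OF T _ d]) (use t 2 in auto)
      moreover have "T = insert ?d (T - {?d})"
        using t 2 by auto
      ultimately show ?thesis by blast
    qed
  qed
qed

lemma tiling_rank_insert_single:
  assumes "T \<in> fib_tilings (Suc m)"
  shows "tiling_rank (Suc (Suc m)) (insert {Suc (Suc m)} T) = tiling_rank (Suc m) T"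
proof -
  have "i \<le> Suc m" if "{i - 1, i} \<in> T" for i
    using fib_tilings_subset[OF assms that] by auto
  \<comment> \<open>For \<open>i \<ge> 2\<close> the set \<open>{i - 1, i}\<close> has two elements,
    so it differs from the new tile.\<close>
  then have "{i \<in> {2..Suc (Suc m)}. {i - 1, i} \<in> insert {Suc (Suc m)} T} =
      {i \<in> {2..Suc m}. {i - 1, i} \<in> T}"
    by (force simp: doubleton_eq_iff)
  then show ?thesis
    by (simp add: tiling_rank_def)
qed

lemma tiling_rank_insert_double:
  assumes "0 < m" "T \<in> fib_tilings m"
  shows "tiling_rank (Suc (Suc m)) (insert {Suc m, Suc (Suc m)} T) = fib (Suc m) + tiling_rank m T"
proof -
  have "i \<le> m" if "{i - 1, i} \<in> T" for i
    using fib_tilings_subset[OF assms(2) that] by auto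
  \<comment> \<open>The new tile is counted only at \<open>i = Suc (Suc m)\<close>, where it adds
    \<open>fib (i - 1) = fib (Suc m)\<close>.\<close>
  then have "{i \<in> {2..Suc (Suc m)}. {i - 1, i} \<in> insert {Suc m, Suc (Suc m)} T} =
      insert (Suc (Suc m)) {i \<in> {2..m}. {i - 1, i} \<in> T}"
    using assms(1) by (force simp: doubleton_eq_iff)
  then show ?thesis
    by (simp add: tiling_rank_def)
qed

lemma sum_power_tiling_rank:
  fixes q :: "'a::field"
  assumes "q \<noteq> 1"
  shows "(\<Sum>T\<in>fib_tilings m. q ^ tiling_rank m T) = qint q (int (fib m))"
proof (induction m rule: fib.induct)
  case 1
  then show ?case by (simp add: fib_tilings_0 qint_def)
next
  case 2
  then show ?case using assms by (simp add: fib_tilings_1 tiling_rank_def qint_def)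
next
  case (3 m)
  let ?s = "{Suc (Suc m)}" and ?d = "{Suc m, Suc (Suc m)}"
  let ?w = "\<lambda>m T. q ^ tiling_rank m T"
  have s: "?s \<notin> T" "?d \<notin> T" if "T \<in> fib_tilings (Suc m)" for T
    using fib_tilings_subset[OF that] by force+
  have d: "?d \<notin> T" if "T \<in> fib_tilings m" for T
    using fib_tilings_subset[OF that] by force
  \<comment> \<open>The tile \<open>?d\<close> reaches above level \<open>Suc m\<close>, so it never
    occurs in \<open>insert ?s T\<close>; the two images are therefore disjoint.\<close>
  have "insert ?s T \<noteq> insert ?d T'" if "T \<in> fib_tilings (Suc m)" for T T'
  proof -
    have "?d \<notin> insert ?s T"
      using s(2)[OF that] by auto
    then show ?thesis by (metis insertI1)
  qed
  then have "insert ?s ` fib_tilings (Suc m) \<inter> insert ?d ` fib_tilings m = {}"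
    by blast
  then have "(\<Sum>T\<in>fib_tilings (Suc (Suc m)). ?w (Suc (Suc m)) T) =
      (\<Sum>T\<in>insert ?s ` fib_tilings (Suc m). ?w (Suc (Suc m)) T) +
      (\<Sum>T\<in>insert ?d ` fib_tilings m. ?w (Suc (Suc m)) T)"
    unfolding fib_tilings_Suc_Suc by (intro sum.union_disjoint) (simp_all add: finite_fib_tilings)
  also have "(\<Sum>T\<in>insert ?s ` fib_tilings (Suc m). ?w (Suc (Suc m)) T) =
      (\<Sum>T\<in>fib_tilings (Suc m). ?w (Suc m) T)"
    by (subst sum.reindex)
      (use s in \<open>auto simp: inj_on_def insert_ident tiling_rank_insert_single intro!: sum.cong\<close>)
  also have "(\<Sum>T\<in>insert ?d ` fib_tilings m. ?w (Suc (Suc m)) T) =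
      (\<Sum>T\<in>fib_tilings m. q ^ fib (Suc m) * ?w m T)"
  \<comment> \<open>For \<open>m = 0\<close> both sums are empty; otherwise the top tile contributes
    the constant factor \<open>q ^ fib (Suc m)\<close>.\<close>
  proof (cases "m = 0")
    case True
    then show ?thesis by (simp add: fib_tilings_0)
  next
    case False
    then show ?thesis
      by (subst sum.reindex)
        (use d in \<open>auto simp: inj_on_def insert_ident tiling_rank_insert_double power_add
            simp del: fib.simps intro!: sum.cong\<close>)
  qed
  also have "\<dots> = q ^ fib (Suc m) * qint q (int (fib m))"
    by (simp only: sum_distrib_left[symmetric] 3)
  finally show ?case
    using 3 qint_add[OF assms, of "fib m" "fib (Suc m)"] by (simp add: add.commute)
qed

lemma sum_fib_file_placements:
  fixes w :: "nat \<Rightarrow> nat set set \<Rightarrow> 'a::comm_semiring_1"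
  shows "(\<Sum>k=0..n. (\<Sum>(I, T)\<in>fib_file_placements n b k.
             (\<Prod>i\<in>I. w i (T i)) * (\<Prod>j\<in>{1..n} - I. c j)) * y ^ (n - k)) =
         (\<Prod>i=1..n. (\<Sum>t\<in>fib_tilings (b i). w i t) + c i * y)"
proof -
  let ?R = "\<lambda>i. \<Sum>t\<in>fib_tilings (b i). w i t"
  \<comment> \<open>The power \<open>y ^ (n - k)\<close> is spread as one factor \<open>y\<close>
    over each of the \<open>n - k\<close> columns outside \<open>I\<close>.\<close>
  let ?g = "\<lambda>I. (\<Prod>i\<in>I. ?R i) * (\<Prod>j\<in>{1..n} - I. c j * y)"
  have fin: "finite I" if "I \<subseteq> {1..n}" for I
    using that finite_subset by blast
  have "(\<Sum>(I, T)\<in>fib_file_placements n b k.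
          (\<Prod>i\<in>I. w i (T i)) * (\<Prod>j\<in>{1..n} - I. c j)) * y ^ (n - k) =
        (\<Sum>I\<in>{I \<in> Pow {1..n}. card I = k}. ?g I)" for k
  proof -
    have "(\<Sum>(I, T)\<in>fib_file_placements n b k.
            (\<Prod>i\<in>I. w i (T i)) * (\<Prod>j\<in>{1..n} - I. c j)) =
          (\<Sum>I\<in>{I \<in> Pow {1..n}. card I = k}. \<Sum>T\<in>(\<Pi>\<^sub>E i\<in>I. fib_tilings (b i)).
            (\<Prod>i\<in>I. w i (T i)) * (\<Prod>j\<in>{1..n} - I. c j))"
      unfolding fib_file_placements_def
      by (subst sum.Sigma) (auto intro!: finite_PiE finite_fib_tilings fin)
    also have "\<dots> = (\<Sum>I\<in>{I \<in> Pow {1..n}. card I = k}.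
            (\<Prod>i\<in>I. ?R i) * (\<Prod>j\<in>{1..n} - I. c j))"
      \<comment> \<open>Choosing the tilings independently in each column of \<open>I\<close> turns
        the sum over \<open>T\<close> into a product of sums.\<close>
      by (rule sum.cong)
        (auto simp: prod_sum_PiE[OF fin finite_fib_tilings] sum_distrib_right)
    finally show ?thesis
      by (auto simp: sum_distrib_right prod.distrib card_Diff_subset fin mult.assoc intro!: sum.cong)
  qed
  then have "(\<Sum>k=0..n. (\<Sum>(I, T)\<in>fib_file_placements n b k.
             (\<Prod>i\<in>I. w i (T i)) * (\<Prod>j\<in>{1..n} - I. c j)) * y ^ (n - k)) =
      (\<Sum>k=0..n. \<Sum>I\<in>{I \<in> Pow {1..n}. card I = k}. ?g I)"
    by simp
  \<comment> \<open>The inner sums group the subsets of \<open>{1..n}\<close> by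
    cardinality.\<close>
  also have "\<dots> = (\<Sum>I\<in>Pow {1..n}. ?g I)"
  proof (rule sum.group)
    show "card ` Pow {1..n} \<subseteq> {0..n}"
      using card_mono[of "{1..n}"] by fastforce
  qed auto
  also have "\<dots> = (\<Prod>i=1..n. ?R i + c i * y)"
    by (rule prod_add[symmetric]) simp
  finally show ?thesis .
qed

theorem theorem5:
  fixes n x :: nat and b :: "nat \<Rightarrow> nat" and q :: "'a::field"
  assumes "n \<ge> 1" and "mono_on {1..n} b" and "b n > 0" and "q \<noteq> 1" and "x > 0"
  shows "(\<Prod>i=1..n. qint q (int x + int (fib (b i)))) =
           (\<Sum>k=0..n. FT n b k q * qint q (int x) ^ (n - k)) \<and>
         (\<Prod>i=1..n. qint q (int x) + qint q (int (fib (b i)))) =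
           (\<Sum>k=0..n. FT_bar n b k q * qint q (int x) ^ (n - k))"
proof
  let ?w = "\<lambda>i T. q ^ tiling_rank (b i) T"
  note R = sum_power_tiling_rank[OF assms(4)]
  have "FT n b k q = (\<Sum>(I, T)\<in>fib_file_placements n b k.
      (\<Prod>i\<in>I. ?w i (T i)) * (\<Prod>j\<in>{1..n} - I. q ^ fib (b j)))" for k
    by (simp add: FT_def FT_weight_def power_add power_sum)
  then show "(\<Prod>i=1..n. qint q (int x + int (fib (b i)))) =
      (\<Sum>k=0..n. FT n b k q * qint q (int x) ^ (n - k))"
    using sum_fib_file_placements[where w = ?w and c = "\<lambda>j. q ^ fib (b j)"]
    by (simp only: R qint_add[OF assms(4)] add.commute)
  have "FT_bar n b k q = (\<Sum>(I, T)\<in>fib_file_placements n b k.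
      (\<Prod>i\<in>I. ?w i (T i)) * (\<Prod>j\<in>{1..n} - I. 1))" for k
    by (simp add: FT_bar_def FT_weight_bar_def power_sum)
  then show "(\<Prod>i=1..n. qint q (int x) + qint q (int (fib (b i)))) =
      (\<Sum>k=0..n. FT_bar n b k q * qint q (int x) ^ (n - k))"
    using sum_fib_file_placements[where w = ?w and c = "\<lambda>_. 1"]
    by (simp only: R mult_1 add.commute)
qed

end
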